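(* Let $m_0,m_1\in\mathbb{Q}$ and let $(m_n)_{n\ge0}$ be the sequence of rational numbers determined by $m_0,m_1$ and the recurrence \[(n+2)m_n=(2n+1)m_{n-1}+(3n-3)m_{n-2}\quad (n\ge 2).\] Let $M(x)=\sum_{n\ge0} m_n x^n$. The following statements are equivalent: (1) $M(x)$ is algebraic; (2) $M(x)$ is globally bounded; (3) there exists $b\in\mathbb{Z}\setminus\{0\}$ such that $m_n\in\frac{1}{b}\mathbb{Z}$ for all $n\ge0$; (4) $m_0=m_1$; (5) $M(x)$ is the diagonal of some bivariate rational function.
   Context: A power series $f\in\mathbb{Q}[[x]]$ is algebraic if it is algebraic over $\mathbb{Q}(x)$. A power series $f(x)=\sum_{n\ge0}a_nx^n\in\mathbb{Q}[[x]]$ is almost integral if there exists $C\in\mathbb{Z}\setminus\{0\}$ with $C^na_n\in\mathbb{Z}$ for all $n\ge1$; it is globally bounded if it is almost integral and has a nonzero radius of convergence in $\mathbb{C}$. The diagonal of $R=\sum_{n_1,n_2\ge0}c(n_1,n_2)x_1^{n_1}x_2^{n_2}\in\mathbb{Q}[[x_1,x_2]]$ is $\sum_{n\ge0}c(n,n)t^n$; "diagonal of a bivariate rational function" means the diagonal of a rational function in $\mathbb{Q}(x_1,x_2)$ that admits a power series expansion in $\mathbb{Q}[[x_1,x_2]]$. *)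

theory Defs
  imports
    "HOL-Computational_Algebra.Computational_Algebra"
    "HOL-Analysis.FPS_Convergence"
begin

text \<open>The field $\mathbb{Q}(x)$, as a subfield of the field of formal Laurent series.\<close>

definition ratfun_fls :: "rat fls set" where
  "ratfun_fls = {fps_to_fls (fps_of_poly p) / fps_to_fls (fps_of_poly q) | p q. q \<noteq> 0}"

definition algebraic_fps :: "rat fps \<Rightarrow> bool" where
  "algebraic_fps f \<longleftrightarrow>
     (\<exists>p :: rat fls poly. p \<noteq> 0 \<and> (\<forall>i. coeff p i \<in> ratfun_fls) \<and> poly p (fps_to_fls f) = 0)"

definition almost_integral :: "rat fps \<Rightarrow> bool" where
  "almost_integral f \<longleftrightarrow>
     (\<exists>C :: int. C \<noteq> 0 \<and> (\<forall>n\<ge>1. of_int C ^ n * fps_nth f n \<in> \<int>))"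

definition complex_fps :: "rat fps \<Rightarrow> complex fps" where
  "complex_fps f = Abs_fps (\<lambda>n. of_rat (fps_nth f n))"

definition globally_bounded :: "rat fps \<Rightarrow> bool" where
  "globally_bounded f \<longleftrightarrow> almost_integral f \<and> fps_conv_radius (complex_fps f) > 0"

text \<open>
  A bivariate series $\sum c(n_1,n_2) x_1^{n_1} x_2^{n_2}$ is encoded as a series in $x_1$ whose
  coefficients are series in $x_2$, and likewise for polynomials, so that
  $c(n_1,n_2)$ is the \<open>n\<^sub>2\<close>-th coefficient of the \<open>n\<^sub>1\<close>-th coefficient.
\<close>

definition fps2_of_poly2 :: "rat poly poly \<Rightarrow> rat fps fps" where
  "fps2_of_poly2 P = fps_of_poly (map_poly fps_of_poly P)"

definition diagonal :: "rat fps fps \<Rightarrow> rat fps" where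
  "diagonal F = Abs_fps (\<lambda>n. fps_nth (fps_nth F n) n)"

text \<open>
  The rational function $R = P/Q$ and the power series $F$ coincide in the fraction field of
  $\mathbb{Q}[[x_1,x_2]]$.  The constant term of $Q$ is not required to be nonzero.
\<close>

definition has_fps2_expansion :: "rat poly poly fract \<Rightarrow> rat fps fps \<Rightarrow> bool" where
  "has_fps2_expansion R F \<longleftrightarrow>
     (\<exists>P Q. Q \<noteq> 0 \<and> R = Fract P Q \<and> fps2_of_poly2 Q * F = fps2_of_poly2 P)"

definition diagonal_of_bivariate_ratfun :: "rat fps \<Rightarrow> bool" where
  "diagonal_of_bivariate_ratfun f \<longleftrightarrow>
     (\<exists>(R :: rat poly poly fract) F. has_fps2_expansion R F \<and> f = diagonal F)"

end

theory Submission
  imports Defs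
begin

text \<open>
  Put \<open>D = 1 - 2 x - 3 x\<^sup>2\<close> and \<open>v = x\<^sup>2 M\<close>.  The recurrence says that
  \<open>D v' + (1 + 3 x) v = 2 m\<^sub>0 x + 3 (m\<^sub>1 - m\<^sub>0) x\<^sup>2\<close>, where \<open>1 + 3 x = - D'/2\<close>.
  For an odd prime \<open>p = 2 e + 3\<close>, the product \<open>D\<^bsup>e+1\<^esup> v\<close> therefore has derivative
  \<open>D\<^sup>e (2 m\<^sub>0 x + 3 (m\<^sub>1 - m\<^sub>0) x\<^sup>2) - p D\<^sup>e (1 + 3 x) v\<close>, and comparing coefficients of
  \<open>x\<^bsup>p-1\<^esup>\<close> shows that \<open>3 (m\<^sub>1 - m\<^sub>0) (-3)\<^sup>e\<close> is \<open>p\<close> times an integral combination of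
  coefficients of \<open>v\<close>.  If the denominators of these grow at most geometrically, a large \<open>p\<close>
  gives \<open>m\<^sub>0 = m\<^sub>1\<close>.  This covers (2), (3) and also (5), since every power series equal to a
  rational function in two variables has such denominators.  If \<open>M\<close> is algebraic, the trace of
  \<open>M\<close> yields a rational solution of the same differential equation, to which the same argument
  applies.  Conversely, if \<open>m\<^sub>0 = m\<^sub>1\<close>, then \<open>m\<^sub>n\<close> is \<open>m\<^sub>0\<close> times the coefficient of \<open>x\<^sup>n\<close> in
  \<open>(1 + x + x\<^sup>2)\<^sup>n (1 - x\<^sup>2)\<close>, and \<open>(m\<^sub>0 (1 - x) - 2 v)\<^sup>2 = m\<^sub>0\<^sup>2 D\<close>.
\<close>

section \<open>Sequences whose denominators grow at most geometrically\<close>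

text \<open>The exponent \<open>Suc n\<close> lets the term at index 0 have a denominator as
  well.\<close>

definition geometric_denominators :: "(nat \<Rightarrow> rat) \<Rightarrow> bool" where
  "geometric_denominators a \<longleftrightarrow> (\<exists>C :: int. C \<noteq> 0 \<and> (\<forall>n. of_int C ^ Suc n * a n \<in> \<int>))"

lemma rat_common_denominator:
  fixes a :: rat
  obtains w :: int where "w \<noteq> 0" "of_int w * a \<in> \<int>"
proof -
  obtain u w where uw: "quotient_of a = (u, w)" by force
  have "w > 0" using quotient_of_denom_pos[OF uw] .
  moreover have "of_int w * a = of_int u"
    using quotient_of_div[OF uw] \<open>w > 0\<close> by (simp add: field_simps)
  ultimately show ?thesis using that[of w] by simp
qed

text \<open>Almost integrality says nothing about the constant term, so its denominator
  \<open>w\<close> is multiplied into \<open>C\<close>.\<close>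

lemma almost_integral_imp_geometric_denominators:
  assumes "almost_integral f"
  shows "geometric_denominators (fps_nth f)"
proof -
  obtain C :: int where C: "C \<noteq> 0" "\<And>n. n \<ge> 1 \<Longrightarrow> of_int C ^ n * fps_nth f n \<in> \<int>"
    using assms unfolding almost_integral_def by blast
  obtain w :: int where w: "w \<noteq> 0" "of_int w * fps_nth f 0 \<in> \<int>"
    by (rule rat_common_denominator)
  have "of_int (C * w) ^ Suc n * fps_nth f n \<in> \<int>" for n
  proof (cases "n = 0")
    case True
    have "of_int C * (of_int w * fps_nth f 0) \<in> \<int>" by (intro Ints_mult Ints_of_int w)
    then show ?thesis using True by (simp add: mult.assoc)
  next
    case False
    then have "of_int (C * w ^ Suc n) * (of_int C ^ n * fps_nth f n) \<in> \<int>"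
      using False by (intro Ints_mult Ints_of_int C) simp
    then show ?thesis by (simp add: power_mult_distrib mult_ac)
  qed
  moreover have "C * w \<noteq> 0" using C w by simp
  ultimately show ?thesis unfolding geometric_denominators_def by blast
qed

lemma geometric_denominators_shift:
  assumes "geometric_denominators (\<lambda>n. a (n + k))" "\<And>n. n < k \<Longrightarrow> a n = 0"
  shows "geometric_denominators a"
proof -
  obtain C :: int where C: "C \<noteq> 0" "\<And>n. of_int C ^ Suc n * a (n + k) \<in> \<int>"
    using assms(1) unfolding geometric_denominators_def by blast
  have "of_int C ^ Suc n * a n \<in> \<int>" for n
  proof (cases "n < k")
    case False
    then obtain j where n: "n = j + k" by (metis add.commute le_Suc_ex not_less)
    have "of_int C ^ k * (of_int C ^ Suc j * a (j + k)) \<in> \<int>"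
      by (intro Ints_mult Ints_power Ints_of_int C)
    then show ?thesis by (simp add: n power_add mult_ac)
  qed (use assms(2) in auto)
  with C(1) show ?thesis unfolding geometric_denominators_def by blast
qed

subsection \<open>Denominators of solutions of the differential equation\<close>

text \<open>The discriminant (1 - x)^2 - 4 x^2 of the equation x^2 Y^2 - (1 - x) Y + 1 = 0 of the
  Motzkin series.\<close>

definition motzkin_disc :: "rat poly" where
  "motzkin_disc = [:1, -2, -3:]"

lemma fps_of_motzkin_disc:
  "fps_of_poly motzkin_disc = 1 - 2 * fps_X - 3 * fps_X ^ 2"
  by (simp add: motzkin_disc_def fps_of_poly_pCons algebra_simps power2_eq_square
      flip: numeral_fps_const)

lemma motzkin_disc_power_coeff_Ints: "coeff (motzkin_disc ^ e) n \<in> \<int>"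
proof -
  have "coeff motzkin_disc k \<in> \<int>" for k
    by (simp add: motzkin_disc_def coeff_pCons split: nat.split)
  then show ?thesis
    by (induction e arbitrary: n)
       (auto simp: coeff_mult coeff_1 intro!: Ints_sum Ints_mult)
qed

lemma motzkin_disc_power_coeff:
  shows "coeff (motzkin_disc ^ e) (2 * e) = (- 3) ^ e"
    and "n > 2 * e \<Longrightarrow> coeff (motzkin_disc ^ e) n = 0"
proof -
  have deg: "degree (motzkin_disc ^ e) = 2 * e"
    by (simp add: motzkin_disc_def degree_power_eq)
  then show "coeff (motzkin_disc ^ e) (2 * e) = (- 3) ^ e"
    using lead_coeff_power[of motzkin_disc e] by (simp add: motzkin_disc_def)
  show "coeff (motzkin_disc ^ e) n = 0" if "n > 2 * e"
    using that deg by (simp add: coeff_eq_0)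
qed

text \<open>The term with \<open>v (n - i)\<close> only needs the power \<open>Suc (n - i)\<close>
  of \<open>C\<close>, which divides the power \<open>Suc n\<close>.\<close>

lemma Ints_fps_mult_geometric:
  fixes f v :: "rat fps"
  assumes "\<And>n. fps_nth f n \<in> \<int>" "\<And>n. of_int C ^ Suc n * fps_nth v n \<in> \<int>"
  shows "of_int C ^ Suc n * fps_nth (f * v) n \<in> \<int>"
proof -
  have "of_int C ^ Suc n * (fps_nth f i * fps_nth v (n - i)) \<in> \<int>" if "i \<le> n" for i
  proof -
    have "of_int C ^ i * (fps_nth f i * (of_int C ^ Suc (n - i) * fps_nth v (n - i))) \<in> \<int>"
      by (intro Ints_mult Ints_power Ints_of_int assms)
    moreover have "of_int C ^ Suc n = (of_int C ^ i * of_int C ^ Suc (n - i) :: rat)"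
      using that by (simp del: power_Suc add: Suc_diff_le flip: power_add)
    ultimately show ?thesis by (simp only: mult_ac)
  qed
  then show ?thesis
    by (auto simp: fps_mult_nth sum_distrib_left intro!: Ints_sum)
qed

lemma motzkin_ode_geometric_denominators:
  fixes v :: "rat fps" and a b :: rat
  assumes ode: "fps_of_poly motzkin_disc * fps_deriv v + (1 + 3 * fps_X) * v =
      fps_const a * fps_X + fps_const b * fps_X ^ 2"
    and den: "geometric_denominators (fps_nth v)"
  shows "b = 0"
proof (rule ccontr)
  assume "b \<noteq> 0"
  obtain C :: int where C: "C \<noteq> 0" "\<And>n. of_int C ^ Suc n * fps_nth v n \<in> \<int>"
    using den unfolding geometric_denominators_def by blast
  obtain w :: int where w: "w \<noteq> 0" "of_int w * b \<in> \<int>"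
    by (rule rat_common_denominator)
  then obtain u :: int where u: "of_int w * b = of_int u" by (auto elim: Ints_cases)
  have "u \<noteq> 0" using u w \<open>b \<noteq> 0\<close> by auto
  \<comment> \<open>This size keeps \<open>p\<close> from dividing 3, \<open>C\<close> or the
    numerator \<open>u\<close> of \<open>b\<close>.\<close>
  obtain p :: nat where p: "prime p" "p > 3 + nat \<bar>C\<bar> + nat \<bar>u\<bar>"
    using bigger_prime by blast
  then have "odd p" using prime_odd_nat[of p] by auto
  define e where "e = (p - 3) div 2"
  have pe: "p = 2 * e + 3" using p \<open>odd p\<close> unfolding e_def by (auto elim!: oddE)
  define D where "D = fps_of_poly motzkin_disc"
  define H :: "rat fps" where "H = 1 + 3 * fps_X"
  have D': "fps_deriv D = - (2 * H)"
    by (simp add: D_def H_def fps_of_motzkin_disc fps_deriv_power algebra_simps)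
  have Dpow: "D ^ k = fps_of_poly (motzkin_disc ^ k)" for k
    by (simp add: D_def fps_of_poly_power)
  have intD: "fps_nth (D ^ k) n \<in> \<int>" for k n
    by (simp add: Dpow motzkin_disc_power_coeff_Ints)
  have intDH: "fps_nth (D ^ e * H) n \<in> \<int>" for n
  proof -
    have "D ^ e * H = D ^ e + 3 * (D ^ e * fps_X)" by (simp add: H_def algebra_simps)
    then show ?thesis using intD by (auto simp: numeral_fps_const)
  qed
  \<comment> \<open>Differentiating the power contributes -2 (e + 1) \<open>D ^ e * H * v\<close>;
    completing \<open>D * v'\<close> by \<open>H * v\<close> subtracts one more copy, and 2 (e + 1)
    + 1 = p.\<close>
  have "fps_deriv (D ^ Suc e * v) =
      D ^ e * (D * fps_deriv v + H * v) - of_nat p * (D ^ e * H * v)"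
    by (simp add: fps_deriv_power D' pe algebra_simps del: power_Suc flip: fps_const_add)
       (simp add: algebra_simps fps_of_nat flip: fps_const_add)
  also have "D * fps_deriv v + H * v = fps_const a * fps_X + fps_const b * fps_X ^ 2"
    using ode by (simp add: D_def H_def)
  finally have eq: "fps_deriv (D ^ Suc e * v) = fps_const a * (D ^ e * fps_X) +
      fps_const b * (D ^ e * fps_X * fps_X) - fps_const (of_nat p) * (D ^ e * H * v)"
    by (simp add: algebra_simps power2_eq_square fps_of_nat)
  have "of_nat p * fps_nth (D ^ Suc e * v) p = fps_nth (fps_deriv (D ^ Suc e * v)) (p - 1)"
    using p unfolding fps_deriv_nth by (simp del: power_Suc)
  \<comment> \<open>Since p - 1 = 2 e + 2, the \<open>b\<close> term meets the leading coefficient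
    of \<open>D ^ e\<close>, while the \<open>a\<close> term asks for its coefficient at 2 e + 1,
    which is zero.\<close>
  also have "\<dots> = b * (- 3) ^ e - of_nat p * fps_nth (D ^ e * H * v) (p - 1)"
    unfolding eq by (simp add: pe Dpow motzkin_disc_power_coeff del: power_Suc)
  finally have key: "of_nat p * (fps_nth (D ^ Suc e * v) p + fps_nth (D ^ e * H * v) (p - 1)) =
      b * (- 3) ^ e"
    by (simp add: distrib_left)
  define z where "z = fps_nth (D ^ Suc e * v) p + fps_nth (D ^ e * H * v) (p - 1)"
  have "of_int C ^ Suc p * fps_nth (D ^ Suc e * v) p \<in> \<int>"
    by (rule Ints_fps_mult_geometric[OF intD C(2)])
  moreover have "of_int C * (of_int C ^ Suc (p - 1) * fps_nth (D ^ e * H * v) (p - 1)) \<in> \<int>"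
    by (intro Ints_mult Ints_fps_mult_geometric[OF intDH C(2)]) auto
  ultimately have "of_int C ^ Suc p * z \<in> \<int>"
    using p by (simp add: z_def algebra_simps)
  then obtain k :: int where k: "of_int C ^ Suc p * z = of_int k" by (auto elim: Ints_cases)
  have "of_int (int p * (w * k)) = (of_int (C ^ Suc p * (u * (- 3) ^ e)) :: rat)"
  proof -
    have "of_int (int p * (w * k)) = of_int C ^ Suc p * (of_int w * (of_nat p * z))"
      using k[symmetric] by simp
    also have "\<dots> = of_int C ^ Suc p * (of_int w * b * (- 3) ^ e)"
      using key by (simp add: z_def mult_ac)
    finally show ?thesis by (simp add: u)
  qed
  then have "int p dvd C ^ Suc p * (u * (- 3) ^ e)"
    by (metis dvd_triv_left of_int_eq_iff)
  moreover have "prime (int p)" using p by simp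
  ultimately have "int p dvd C \<or> int p dvd u \<or> int p dvd - 3"
    by (meson prime_dvd_multD prime_dvd_power)
  moreover have "\<not> int p dvd x" if "x \<noteq> 0" "\<bar>x\<bar> < int p" for x
    using that by (metis dvd_imp_le_int abs_of_nat not_le)
  moreover have "\<bar>C\<bar> < int p" "\<bar>u\<bar> < int p" "\<bar>- 3\<bar> < int p" using p(2) by linarith+
  ultimately show False using C(1) \<open>u \<noteq> 0\<close> by auto
qed

subsection \<open>Rational functions in two variables\<close>

text \<open>
  Solving \<open>G F = H\<close> for the coefficients of \<open>F\<close> divides only by the lexicographically first nonzero
  coefficient of \<open>G\<close>, at \<open>(a, b)\<close>.  The weight \<open>(b + 1) i + j\<close> decreases in this recursion, so it
  bounds the exponent of that coefficient in the denominator.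
\<close>

lemma fps2_divide_denominators:
  fixes F G H :: "rat fps fps"
  assumes eq: "G * F = H" and "G \<noteq> 0"
    and intG: "\<And>i j. fps_nth (fps_nth G i) j \<in> \<int>"
    and intH: "\<And>i j. fps_nth (fps_nth H i) j \<in> \<int>"
  obtains C :: int and N where "C \<noteq> 0"
    "\<And>i j. of_int C ^ Suc (N * i + j) * fps_nth (fps_nth F i) j \<in> \<int>"
proof -
  define g f h where "g = (\<lambda>i j. fps_nth (fps_nth G i) j)"
    and "f = (\<lambda>i j. fps_nth (fps_nth F i) j)" and "h = (\<lambda>i j. fps_nth (fps_nth H i) j)"
  define a where "a = subdegree G"
  define b where "b = subdegree (fps_nth G a)"
  have Ga: "fps_nth G a \<noteq> 0" using \<open>G \<noteq> 0\<close> by (simp add: a_def)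
  have gab: "g a b \<noteq> 0" using Ga by (simp add: g_def b_def)
  have g0: "g i j = 0" if "i < a \<or> (i = a \<and> j < b)" for i j
    using that by (auto simp: g_def a_def b_def)
  obtain C :: int where C: "g a b = of_int C"
    using intG[of a b] by (auto simp: g_def elim: Ints_cases)
  have "C \<noteq> 0" using C gab by auto
  \<comment> \<open>Going back one row saves b + 1 in the weight, more than the column index can
    gain, which is at most b.\<close>
  define N where "N = Suc b"
  have conv: "(\<Sum>k\<le>i. \<Sum>l\<le>j. g k l * f (i - k) (j - l)) = h i j" for i j
    unfolding h_def eq[symmetric] fps_mult_nth fps_sum_nth g_def f_def atMost_atLeast0 ..
  have "of_int C ^ Suc (N * i + j) * f i j \<in> \<int>" for i j
  proof (induction "N * i + j" arbitrary: i j rule: less_induct)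
    case less
    let ?W = "N * i + j"
    define T where "T = {..i + a} \<times> {..j + b}"
    define t where "t = (\<lambda>(k, l). g k l * f (i + a - k) (j + b - l))"
    have "(a, b) \<in> T" by (simp add: T_def)
    \<comment> \<open>In the coefficient of \<open>G * F\<close> at (i + a, j + b), the term of
      \<open>G\<close> at (a, b) is the one that carries \<open>f i j\<close>.\<close>
    have "h (i + a) (j + b) = (\<Sum>x\<in>T. t x)"
      unfolding conv[symmetric] T_def t_def by (simp add: sum.cartesian_product)
    also have "\<dots> = of_int C * f i j + (\<Sum>x\<in>T - {(a, b)}. t x)"
      using \<open>(a, b) \<in> T\<close> by (subst sum.remove[of _ "(a, b)"]) (auto simp: T_def t_def C)
    finally have eq: "of_int C ^ Suc ?W * f i j =
        of_int C ^ ?W * h (i + a) (j + b) - (\<Sum>x\<in>T - {(a, b)}. of_int C ^ ?W * t x)"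
      by (simp add: algebra_simps sum_distrib_left)
    have "(\<Sum>x\<in>T - {(a, b)}. of_int C ^ ?W * t x) \<in> \<int>"
    proof (rule Ints_sum)
      fix x assume x: "x \<in> T - {(a, b)}"
      show "of_int C ^ ?W * t x \<in> \<int>"
      proof (cases x)
        case (Pair k l)
        show ?thesis
        proof (cases "k < a \<or> (k = a \<and> l < b)")
          case True
          then show ?thesis using g0 by (auto simp: Pair t_def)
        next
          case False
          let ?V = "N * (i + a - k) + (j + b - l)"
          have kl: "k \<le> i + a" "l \<le> j + b" "(k, l) \<noteq> (a, b)" using x Pair by (auto simp: T_def)
          have lt: "?V < ?W"
          proof (cases "k = a")
            case True
            then show ?thesis using False kl by auto
          next
            case k: False
            then have "Suc (i + a - k) \<le> i" using False kl by linarith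
            then have "N * Suc (i + a - k) \<le> N * i" by (rule mult_le_mono2)
            then show ?thesis using kl by (simp add: N_def)
          qed
          then have IH: "of_int C ^ Suc ?V * f (i + a - k) (j + b - l) \<in> \<int>" by (rule less)
          have "g k l * (of_int C ^ (?W - Suc ?V) * (of_int C ^ Suc ?V * f (i + a - k) (j + b - l))) \<in> \<int>"
            unfolding g_def by (intro Ints_mult Ints_power Ints_of_int intG IH)
          moreover have "of_int C ^ ?W = (of_int C ^ (?W - Suc ?V) * of_int C ^ Suc ?V :: rat)"
            unfolding power_add[symmetric] using lt by (metis Suc_leI le_add_diff_inverse2)
          ultimately show ?thesis by (simp only: Pair t_def prod.case mult_ac)
        qed
      qed
    qed
    then show ?case
      unfolding eq h_def by (intro Ints_diff Ints_mult Ints_power Ints_of_int intH)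
  qed
  then show ?thesis using that \<open>C \<noteq> 0\<close> unfolding f_def by blast
qed

lemma poly2_common_denominator:
  fixes P :: "rat poly poly"
  obtains w :: int where "w \<noteq> 0" "\<And>i j. of_int w * coeff (coeff P i) j \<in> \<int>"
proof -
  have 1: "\<exists>w :: int. w \<noteq> 0 \<and> (\<forall>j. of_int w * coeff p j \<in> \<int>)" for p :: "rat poly"
  proof (induction p)
    case (pCons a p)
    then obtain w :: int where w: "w \<noteq> 0" "\<And>j. of_int w * coeff p j \<in> \<int>" by blast
    obtain v :: int where v: "v \<noteq> 0" "of_int v * a \<in> \<int>" by (rule rat_common_denominator)
    have "of_int (v * w) * coeff (pCons a p) j \<in> \<int>" for j
    proof (cases j)
      case 0
      have "of_int w * (of_int v * a) \<in> \<int>" by (intro Ints_mult Ints_of_int v)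
      then show ?thesis using 0 by (simp add: mult_ac)
    next
      case (Suc i)
      have "of_int v * (of_int w * coeff p i) \<in> \<int>" by (intro Ints_mult Ints_of_int w)
      then show ?thesis using Suc by (simp add: mult_ac)
    qed
    moreover have "v * w \<noteq> 0" using v w by simp
    ultimately show ?case by blast
  qed (auto intro: exI[of _ 1])
  have "\<exists>w :: int. w \<noteq> 0 \<and> (\<forall>i j. of_int w * coeff (coeff P i) j \<in> \<int>)"
  proof (induction P)
    case (pCons a p)
    then obtain w :: int where w: "w \<noteq> 0" "\<And>i j. of_int w * coeff (coeff p i) j \<in> \<int>" by blast
    obtain v :: int where v: "v \<noteq> 0" "\<And>j. of_int v * coeff a j \<in> \<int>" using 1[of a] by blast
    have "of_int (v * w) * coeff (coeff (pCons a p) i) j \<in> \<int>" for i j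
    proof (cases i)
      case 0
      have "of_int w * (of_int v * coeff a j) \<in> \<int>" by (intro Ints_mult Ints_of_int v)
      then show ?thesis using 0 by (simp add: mult_ac)
    next
      case (Suc i)
      have "of_int v * (of_int w * coeff (coeff p i) j) \<in> \<int>" by (intro Ints_mult Ints_of_int w)
      then show ?thesis using Suc by (simp add: mult_ac)
    qed
    moreover have "v * w \<noteq> 0" using v w by simp
    ultimately show ?case by blast
  qed (auto intro: exI[of _ 1])
  then show ?thesis using that by blast
qed

lemma fps2_of_poly2_nth [simp]:
  "fps_nth (fps_nth (fps2_of_poly2 P) i) j = coeff (coeff P i) j"
  by (simp add: fps2_of_poly2_def coeff_map_poly)

text \<open>Scaling \<open>P\<close> and \<open>Q\<close> by a common integer makes both integral
  and leaves \<open>F\<close> unchanged.\<close>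

lemma fps2_rational_denominators:
  fixes F :: "rat fps fps"
  assumes "fps2_of_poly2 Q * F = fps2_of_poly2 P" "Q \<noteq> 0"
  obtains C :: int and N where "C \<noteq> 0"
    "\<And>i j. of_int C ^ Suc (N * i + j) * fps_nth (fps_nth F i) j \<in> \<int>"
proof -
  obtain v w :: int where
    v: "v \<noteq> 0" "\<And>i j. of_int v * coeff (coeff P i) j \<in> \<int>" and
    w: "w \<noteq> 0" "\<And>i j. of_int w * coeff (coeff Q i) j \<in> \<int>"
    using poly2_common_denominator by metis
  let ?c = "fps_const (fps_const (of_int (v * w))) :: rat fps fps"
  have "?c * fps2_of_poly2 Q * F = ?c * fps2_of_poly2 P"
    by (simp only: mult.assoc assms(1))
  moreover have "?c * fps2_of_poly2 Q \<noteq> 0"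
  proof -
    have "fps2_of_poly2 Q \<noteq> 0"
      using \<open>Q \<noteq> 0\<close> by (metis fps2_of_poly2_nth fps_zero_nth poly_eqI coeff_0)
    then show ?thesis using v w by (simp add: fps_const_eq_0_iff)
  qed
  moreover have "fps_nth (fps_nth (?c * fps2_of_poly2 Q) i) j \<in> \<int>" for i j
  proof -
    have "of_int v * (of_int w * coeff (coeff Q i) j) \<in> \<int>" by (intro Ints_mult Ints_of_int w)
    then show ?thesis by (simp add: mult_ac)
  qed
  moreover have "fps_nth (fps_nth (?c * fps2_of_poly2 P) i) j \<in> \<int>" for i j
  proof -
    have "of_int w * (of_int v * coeff (coeff P i) j) \<in> \<int>" by (intro Ints_mult Ints_of_int v)
    then show ?thesis by (simp add: mult_ac)
  qed
  ultimately show ?thesis using fps2_divide_denominators that by metis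
qed

lemma geometric_denominators_diagonal:
  assumes "diagonal_of_bivariate_ratfun f"
  shows "geometric_denominators (fps_nth f)"
proof -
  obtain P Q F where PQ: "Q \<noteq> 0" "fps2_of_poly2 Q * F = fps2_of_poly2 P" and f: "f = diagonal F"
    using assms unfolding diagonal_of_bivariate_ratfun_def has_fps2_expansion_def by blast
  obtain C :: int and N where C: "C \<noteq> 0"
    "\<And>i j. of_int C ^ Suc (N * i + j) * fps_nth (fps_nth F i) j \<in> \<int>"
    using fps2_rational_denominators[OF PQ(2,1)] by blast
  \<comment> \<open>On the diagonal the exponent is N n + n + 1, and (N + 1) (n + 1) exceeds it by
    N.\<close>
  have "of_int (C ^ Suc N) ^ Suc n * fps_nth f n \<in> \<int>" for n
  proof -
    have "of_int C ^ N * (of_int C ^ Suc (N * n + n) * fps_nth (fps_nth F n) n) \<in> \<int>"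
      by (intro Ints_mult Ints_power Ints_of_int C)
    moreover have "of_int (C ^ Suc N) ^ Suc n = (of_int C ^ N * of_int C ^ Suc (N * n + n) :: rat)"
      unfolding of_int_power power_mult[symmetric] power_add[symmetric]
      by (rule arg_cong) (simp add: algebra_simps)
    ultimately show ?thesis unfolding f diagonal_def by (simp only: mult_ac fps_nth_Abs_fps)
  qed
  moreover have "C ^ Suc N \<noteq> 0" using C(1) by simp
  ultimately show ?thesis unfolding geometric_denominators_def by blast
qed

text \<open>A rational series in one variable is a bivariate one that is constant in the first
  variable; row 0 of the bivariate bound suffices.\<close>

lemma geometric_denominators_rational:
  fixes f :: "rat fps"
  assumes "fps_of_poly q * f = fps_of_poly p" "q \<noteq> 0"
  shows "geometric_denominators (fps_nth f)"
proof -
  have "fps2_of_poly2 [:r:] = fps_const (fps_of_poly r)" for r :: "rat poly"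
    by (simp add: fps2_of_poly2_def map_poly_pCons fps_of_poly_const)
  then have "fps2_of_poly2 [:q:] * fps_const f = fps2_of_poly2 [:p:]"
    using assms(1) by simp
  then obtain C :: int and N where "C \<noteq> 0"
    "\<And>i j. of_int C ^ Suc (N * i + j) * fps_nth (fps_nth (fps_const f) i) j \<in> \<int>"
    using fps2_rational_denominators[of "[:q:]"] \<open>q \<noteq> 0\<close> by (metis pCons_eq_0_iff)
  from this(1) this(2)[of 0] show ?thesis unfolding geometric_denominators_def by auto
qed

subsection \<open>Algebraic solutions of first-order linear differential equations\<close>

abbreviation fls_of_poly :: "rat poly \<Rightarrow> rat fls" where
  "fls_of_poly p \<equiv> fps_to_fls (fps_of_poly p)"

lemma fls_of_poly_simps:
  "fls_of_poly (p + q) = fls_of_poly p + fls_of_poly q"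
  "fls_of_poly (p - q) = fls_of_poly p - fls_of_poly q"
  "fls_of_poly (p * q) = fls_of_poly p * fls_of_poly q"
  "fls_of_poly (pderiv p) = fls_deriv (fls_of_poly p)"
  by (simp_all add: fps_of_poly_add fps_of_poly_diff fps_of_poly_mult fls_times_fps_to_fls
      fps_of_poly_pderiv fls_deriv_fps_to_fls)

lemma fls_of_poly_eq_0_iff [simp]: "fls_of_poly p = 0 \<longleftrightarrow> p = 0"
  using fps_of_poly_eq_iff[of p 0] by simp

section \<open>The rational functions as a differential subfield\<close>

lemma ratfun_flsE:
  assumes "x \<in> ratfun_fls"
  obtains p q where "q \<noteq> 0" "x = fls_of_poly p / fls_of_poly q"
  using assms unfolding ratfun_fls_def by blast

lemma ratfun_flsI: "q \<noteq> 0 \<Longrightarrow> x = fls_of_poly p / fls_of_poly q \<Longrightarrow> x \<in> ratfun_fls"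
  unfolding ratfun_fls_def by blast

lemma fls_of_poly_in_ratfun_fls: "fls_of_poly p \<in> ratfun_fls"
  by (rule ratfun_flsI[of 1 _ p]) simp_all

lemma ratfun_fls_0: "0 \<in> ratfun_fls"
  using fls_of_poly_in_ratfun_fls[of 0] by simp

lemma ratfun_fls_1: "1 \<in> ratfun_fls"
  using fls_of_poly_in_ratfun_fls[of 1] by simp

lemma ratfun_fls_add:
  assumes "x \<in> ratfun_fls" "y \<in> ratfun_fls"
  shows "x + y \<in> ratfun_fls"
proof -
  obtain p q r s where "q \<noteq> 0" "x = fls_of_poly p / fls_of_poly q"
    and "s \<noteq> 0" "y = fls_of_poly r / fls_of_poly s"
    using assms by (elim ratfun_flsE)
  then show ?thesis
    by (intro ratfun_flsI[of "q * s" _ "p * s + r * q"])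
       (auto simp: fls_of_poly_simps add_frac_eq)
qed

lemma ratfun_fls_mult:
  assumes "x \<in> ratfun_fls" "y \<in> ratfun_fls"
  shows "x * y \<in> ratfun_fls"
proof -
  obtain p q r s where "q \<noteq> 0" "x = fls_of_poly p / fls_of_poly q"
    and "s \<noteq> 0" "y = fls_of_poly r / fls_of_poly s"
    using assms by (elim ratfun_flsE)
  then show ?thesis
    by (intro ratfun_flsI[of "q * s" _ "p * r"]) (auto simp: fls_of_poly_simps)
qed

lemma ratfun_fls_inverse:
  assumes "x \<in> ratfun_fls"
  shows "inverse x \<in> ratfun_fls"
proof -
  obtain p q where "q \<noteq> 0" "x = fls_of_poly p / fls_of_poly q"
    using assms by (elim ratfun_flsE)
  then show ?thesis
    by (cases "p = 0") (auto intro: ratfun_fls_0 ratfun_flsI[of p _ q])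
qed

lemma ratfun_fls_divide: "x \<in> ratfun_fls \<Longrightarrow> y \<in> ratfun_fls \<Longrightarrow> x / y \<in> ratfun_fls"
  using ratfun_fls_mult[OF _ ratfun_fls_inverse, of x y] by (simp add: divide_inverse)

lemma ratfun_fls_of_nat: "of_nat n \<in> ratfun_fls"
  by (induction n) (auto intro: ratfun_fls_0 ratfun_fls_1 ratfun_fls_add)

lemma ratfun_fls_uminus:
  assumes "x \<in> ratfun_fls"
  shows "- x \<in> ratfun_fls"
proof -
  have "- 1 = fls_of_poly (- 1)" by (simp add: fps_of_poly_uminus)
  then have "- 1 * x \<in> ratfun_fls"
    using assms fls_of_poly_in_ratfun_fls[of "- 1"] by (intro ratfun_fls_mult) simp_all
  then show ?thesis by simp
qed

lemma ratfun_fls_deriv: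
  assumes "x \<in> ratfun_fls"
  shows "fls_deriv x \<in> ratfun_fls"
proof -
  obtain p q where q: "q \<noteq> 0" and x: "x = fls_of_poly p / fls_of_poly q"
    using assms by (elim ratfun_flsE)
  have "fls_deriv (x * fls_of_poly q) = fls_of_poly (pderiv p)"
    using q by (simp add: x fls_of_poly_simps)
  then have "fls_deriv x = (fls_of_poly (pderiv p) + - x * fls_of_poly (pderiv q)) / fls_of_poly q"
    using q by (simp add: fls_of_poly_simps field_simps)
  also have "\<dots> \<in> ratfun_fls"
    using assms by (intro ratfun_fls_divide ratfun_fls_add ratfun_fls_mult ratfun_fls_uminus
        fls_of_poly_in_ratfun_fls)
  finally show ?thesis .
qed

lemma fls_deriv_poly:
  "fls_deriv (poly p f) = poly (map_poly fls_deriv p) f + poly (pderiv p) f * fls_deriv f"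
  for p :: "rat fls poly"
  by (induction p) (simp_all add: map_poly_pCons pderiv_pCons algebra_simps)

text \<open>
  Let $y^d + a_{d-1} y^{d-1} + \cdots$ be the minimal polynomial of $y$ over $\mathbb{Q}(x)$.
  Differentiating it and eliminating $y'$ gives a relation of degree less than $d$, which is
  trivial; its coefficient at $y^{d-1}$ says that $-a_{d-1}/d$ solves the same equation as $y$.
\<close>

lemma algebraic_imp_rational_solution:
  fixes A B :: "rat fls"
  assumes alg: "algebraic_fps f" and AB: "A \<in> ratfun_fls" "B \<in> ratfun_fls"
    and ode: "fls_deriv (fps_to_fls f) = A * fps_to_fls f + B"
  obtains T where "T \<in> ratfun_fls" "fls_deriv T = A * T + B"
proof -
  define y where "y = fps_to_fls f"
  define Z where "Z = (\<lambda>p :: rat fls poly. p \<noteq> 0 \<and> (\<forall>i. coeff p i \<in> ratfun_fls) \<and> poly p y = 0)"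
  have "\<exists>p. Z p" using alg unfolding algebraic_fps_def Z_def y_def .
  then obtain p where p: "Z p" and min: "\<And>q. Z q \<Longrightarrow> degree p \<le> degree q"
    using exists_least_iff[of "\<lambda>n. \<exists>p. Z p \<and> degree p = n"] by (metis linorder_not_less)
  define P where "P = smult (inverse (lead_coeff p)) p"
  define d where "d = degree P"
  have "lead_coeff p \<noteq> 0" using p by (simp add: Z_def)
  have PR: "coeff P i \<in> ratfun_fls" for i
    using p unfolding P_def Z_def by (simp add: ratfun_fls_mult ratfun_fls_inverse)
  have Py: "poly P y = 0" using p by (simp add: P_def Z_def)
  have d: "degree p = d" using \<open>lead_coeff p \<noteq> 0\<close> by (simp add: P_def d_def)
  have lc: "coeff P d = 1" using \<open>lead_coeff p \<noteq> 0\<close> d by (simp add: P_def)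
  have high: "coeff P i = 0" if "i > d" for i using that by (simp add: d_def coeff_eq_0)
  have "d \<noteq> 0"
  proof
    assume "d = 0"
    then have "P = 1" using lc d_def by (metis degree_0_id one_pCons)
    then show False using Py by simp
  qed
  then obtain c where dc: "d = Suc c" by (cases d) auto
  \<comment> \<open>The first two summands are the derivative of \<open>P\<close> at
    \<open>y\<close> with \<open>y'\<close> replaced by \<open>A * y + B\<close>; subtracting
    \<open>d * A * P\<close> cancels the coefficient of degree \<open>d\<close>.\<close>
  define Q where "Q = map_poly fls_deriv P + pderiv P * [:B, A:] - smult (of_nat d * A) P"
  have Qc: "coeff Q i = fls_deriv (coeff P i) + of_nat (Suc i) * coeff P (Suc i) * B +
      of_nat i * coeff P i * A - of_nat d * A * coeff P i" for i
    by (cases i) (simp_all add: Q_def coeff_map_poly coeff_pderiv mult_pCons_right algebra_simps)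
  have QR: "coeff Q i \<in> ratfun_fls" for i
    unfolding Qc diff_conv_add_uminus
    by (intro ratfun_fls_add ratfun_fls_mult ratfun_fls_uminus ratfun_fls_deriv ratfun_fls_of_nat PR AB)
  have "poly Q y = fls_deriv (poly P y) - of_nat d * A * poly P y"
    unfolding fls_deriv_poly using ode by (simp add: Q_def y_def algebra_simps)
  then have Qy: "poly Q y = 0" by (simp add: Py)
  have "Q = 0"
  proof (rule ccontr)
    assume "Q \<noteq> 0"
    then have "d \<le> degree Q" using min[of Q] QR Qy d unfolding Z_def by simp
    moreover have "coeff Q i = 0" if "i \<ge> d" for i
      using that lc high by (cases "i = d") (simp_all add: Qc)
    ultimately show False using \<open>Q \<noteq> 0\<close> by (metis leading_coeff_0_iff)
  qed
  then have "coeff Q c = 0" by simp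
  then have eq: "fls_deriv (coeff P c) + of_nat d * B = A * coeff P c"
    using lc unfolding Qc dc by (simp add: algebra_simps)
  \<comment> \<open>The mean of the conjugates of \<open>y\<close>.\<close>
  define T where "T = - coeff P c / of_nat d"
  have "T \<in> ratfun_fls"
    unfolding T_def by (intro ratfun_fls_divide ratfun_fls_uminus PR ratfun_fls_of_nat)
  moreover have "fls_deriv T = A * T + B"
  proof -
    have "of_nat d * T = - coeff P c" using \<open>d \<noteq> 0\<close> by (simp add: T_def)
    then have "of_nat d * fls_deriv T = - fls_deriv (coeff P c)"
      by (metis fls_deriv_mult fls_deriv_of_nat mult_zero_left add_0_right add_0_left fls_deriv_neg)
    also have "\<dots> = of_nat d * (A * T + B)"
      using eq \<open>of_nat d * T = - coeff P c\<close> by (simp add: algebra_simps)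
    finally show ?thesis using \<open>d \<noteq> 0\<close> by simp
  qed
  ultimately show ?thesis using that by blast
qed

subsection \<open>Motzkin numbers\<close>

text \<open>The reflection principle: paths of \<open>n\<close> steps -1, 0, 1 that end at 0, minus
  those that end at -2. In this form integrality and a diagonal representation are visible.\<close>

definition motzkin :: "nat \<Rightarrow> rat" where
  "motzkin n = fps_nth ((1 + fps_X + fps_X ^ 2) ^ n * (1 - fps_X ^ 2)) n"

lemma motzkin_Ints: "motzkin n \<in> \<int>"
proof -
  have mult: "fps_nth (f * g) n \<in> \<int>"
    if "\<And>n. fps_nth f n \<in> \<int>" "\<And>n. fps_nth g n \<in> \<int>" for f g :: "rat fps" and n
    using that by (auto simp: fps_mult_nth intro!: Ints_sum Ints_mult)
  have "fps_nth ((1 + fps_X + fps_X ^ 2 :: rat fps) ^ k) n \<in> \<int>" for k n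
    by (induction k arbitrary: n) (auto simp: fps_one_nth fps_X_nth fps_X_power_nth intro!: mult)
  then show ?thesis
    unfolding motzkin_def by (intro mult) (auto simp: fps_X_power_nth)
qed

text \<open>
  With \<open>P = 1 + x + x\<^sup>2\<close> and \<open>K = 1 - x\<^sup>2\<close>, the following identity shows that the combination
  of the \<open>P\<^sup>n K\<close> in the recurrence is \<open>x G' - n G\<close>, whose coefficient at \<open>x\<^sup>n\<close> vanishes, for
  \<open>G = - K\<^sup>2 P\<^bsup>n-1\<^esup> - (2/n) P\<^sup>n\<close> (multiplied by \<open>n\<close> below).  It rests on \<open>P\<^sup>2 - 2 x P - 3 x\<^sup>2 = K\<^sup>2\<close>.
\<close>

lemma motzkin_certificate:
  fixes x U N :: "'a :: comm_ring_1"
  defines "P \<equiv> 1 + x + x ^ 2" and "K \<equiv> 1 - x ^ 2"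
  shows "x * (- (N * (2 * K * (- (2 * x)) * (P * U) + K ^ 2 * ((N - 1) * (1 + 2 * x) * U)))
        - 2 * (N * (1 + 2 * x) * (P * U))) - N * (- (N * (K ^ 2 * (P * U))) - 2 * (P * (P * U))) =
     N * ((N + 2) * (P * (P * U) * K) - (2 * N + 1) * (x * (P * U * K))
        - (3 * N - 3) * (x * (x * (U * K))))"
  unfolding P_def K_def by (simp add: algebra_simps power2_eq_square)

lemma motzkin_rec:
  "(of_nat n + 4) * motzkin (n + 2) =
     (2 * of_nat n + 5) * motzkin (n + 1) + (3 * of_nat n + 3) * motzkin n"
proof -
  \<comment> \<open>\<open>N\<close> is the index of the recurrence, shifted by 2 so that no
    exponent involves a subtraction.\<close>
  define N :: rat where "N = of_nat (n + 2)"
  define P :: "rat fps" where "P = 1 + fps_X + fps_X ^ 2"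
  define K :: "rat fps" where "K = 1 - fps_X ^ 2"
  define G where "G = - (fps_const N * (K ^ 2 * P ^ (n + 1))) - 2 * P ^ (n + 2)"
  have P': "fps_deriv P = 1 + 2 * fps_X" and K': "fps_deriv K = - (2 * fps_X)"
    by (simp_all add: P_def K_def fps_deriv_power numeral_fps_const)
  have PP: "P ^ (n + 1) = P * P ^ n" "P ^ (n + 2) = P * (P * P ^ n)" by simp_all
  have d1: "fps_deriv (P ^ (n + 1)) = (fps_const N - 1) * (1 + 2 * fps_X) * P ^ n"
    unfolding fps_deriv_power P' by (simp add: N_def flip: fps_const_add)
  have d2: "fps_deriv (P ^ (n + 2)) = fps_const N * (1 + 2 * fps_X) * (P * P ^ n)"
    unfolding fps_deriv_power P' by (simp add: N_def)
  have d3: "fps_deriv (K ^ 2) = 2 * K * (- (2 * fps_X))"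
    by (simp add: power2_eq_square K' algebra_simps)
  have "fps_deriv G = - (fps_const N * (2 * K * (- (2 * fps_X)) * (P * P ^ n) +
      K ^ 2 * ((fps_const N - 1) * (1 + 2 * fps_X) * P ^ n)))
      - 2 * (fps_const N * (1 + 2 * fps_X) * (P * P ^ n))"
    unfolding G_def fps_deriv_sub fps_deriv_neg fps_deriv_mult d1 d2 d3 unfolding PP
    by (simp add: algebra_simps flip: numeral_fps_const)
  then have "fps_X * fps_deriv G - fps_const N * G = fps_const N *
      ((fps_const N + 2) * (P ^ (n + 2) * K) - (2 * fps_const N + 1) * (fps_X * (P ^ (n + 1) * K))
        - (3 * fps_const N - 3) * (fps_X * (fps_X * (P ^ n * K))))"
    unfolding PP G_def by (simp only: motzkin_certificate P_def K_def)
  also have "\<dots> = fps_const (N * (N + 2)) * (P ^ (n + 2) * K)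
      - fps_const (N * (2 * N + 1)) * (fps_X * (P ^ (n + 1) * K))
      - fps_const (N * (3 * N - 3)) * (fps_X * (fps_X * (P ^ n * K)))"
    by (simp add: algebra_simps numeral_fps_const flip: fps_const_add fps_const_sub fps_const_mult)
  finally have eq: "fps_X * fps_deriv G - fps_const N * G = \<dots>" .
  \<comment> \<open>The operator x d/dx multiplies the coefficient at n + 2 by n + 2, that is by
    \<open>N\<close>.\<close>
  have "0 = fps_nth (fps_X * fps_deriv G - fps_const N * G) (n + 2)"
    by (simp add: N_def algebra_simps)
  also have "\<dots> = N * ((N + 2) * motzkin (n + 2) - (2 * N + 1) * motzkin (n + 1)
      - (3 * N - 3) * motzkin n)"
    unfolding eq motzkin_def P_def[symmetric] K_def[symmetric]
    by (simp only: fps_sub_nth fps_mult_left_const_nth fps_X_mult_nth)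
       (simp add: right_diff_distrib mult.assoc del: power_Suc)
  finally have "(N + 2) * motzkin (n + 2) - (2 * N + 1) * motzkin (n + 1) - (3 * N - 3) * motzkin n = 0"
    by (simp add: N_def)
  then show ?thesis by (simp add: N_def algebra_simps)
qed

lemma motzkin_0: "motzkin 0 = 1" and motzkin_1: "motzkin 1 = 1"
  by (simp_all add: motzkin_def fps_X_power_nth distrib_left)

section \<open>Convergence, and regularity at the origin\<close>

lemma geometric_bound_conv_radius:
  assumes "\<And>n. \<bar>fps_nth f n\<bar> \<le> B * c ^ n" "c > 0"
  shows "fps_conv_radius (complex_fps f) > 0"
proof -
  \<comment> \<open>At 1/(2c) the terms are bounded by \<open>B\<close> times those of the geometric
    series of ratio 1/2.\<close>
  define z :: complex where "z = of_real (inverse (2 * of_rat c))"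
  have "c \<noteq> 0" using assms by simp
  have "summable (\<lambda>n. of_rat (fps_nth f n) * z ^ n)"
  proof (rule summable_comparison_test')
    show "summable (\<lambda>n. of_rat B * (1 / 2 :: real) ^ n)"
      by (intro summable_mult summable_geometric) simp
    show "norm (of_rat (fps_nth f n) * z ^ n) \<le> of_rat B * (1 / 2 :: real) ^ n" for n
    proof -
      have "norm (of_rat (fps_nth f n) :: complex) = of_rat \<bar>fps_nth f n\<bar>"
        unfolding abs_of_rat[symmetric]
        by (cases "fps_nth f n") (simp add: of_rat_rat norm_divide)
      also have "\<dots> \<le> of_rat (B * c ^ n)" using assms(1) by (simp only: of_rat_less_eq)
      finally have "norm (of_rat (fps_nth f n) * z ^ n :: complex) \<le> of_rat (B * c ^ n) * norm z ^ n"
        by (simp add: norm_mult norm_power mult_right_mono)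
      also have "norm z = inverse (2 * of_rat c)" using assms(2) by (simp add: z_def norm_inverse norm_mult)
      finally show ?thesis
        using \<open>c \<noteq> 0\<close> by (simp add: of_rat_mult of_rat_power field_simps)
    qed
  qed
  then have "ereal (norm z) \<le> fps_conv_radius (complex_fps f)"
    unfolding fps_conv_radius_def complex_fps_def by (intro conv_radius_geI) simp
  moreover have "norm z > 0" using \<open>c \<noteq> 0\<close> by (simp add: z_def)
  ultimately show ?thesis by (metis ereal_less(2) less_le_trans)
qed

text \<open>The leading factor has value 1 at 0. So if \<open>v\<close> had lowest exponent k < 0,
  the coefficient of x^(k-1) on the left would be k \<open>v k\<close>, nonzero, whereas the right
  side is a power series.\<close>

lemma motzkin_ode_fls_subdegree_nonneg:
  fixes v :: "rat fls"
  assumes "(1 - 2 * fls_X - 3 * fls_X ^ 2) * fls_deriv v + (1 + 3 * fls_X) * v = fps_to_fls r"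
  shows "fls_subdegree v \<ge> 0"
proof (rule ccontr)
  define k where "k = fls_subdegree v"
  assume "\<not> fls_subdegree v \<ge> 0"
  then have k: "k < 0" by (simp add: k_def)
  have low: "fls_nth v i = 0" if "i < k" for i using that by (simp add: k_def)
  have "(1 - 2 * fls_X - 3 * fls_X ^ 2) * fls_deriv v + (1 + 3 * fls_X) * v =
      fls_deriv v - fls_const 2 * (fls_X * fls_deriv v)
        - fls_const 3 * (fls_X * (fls_X * fls_deriv v)) + v + fls_const 3 * (fls_X * v)" (is "_ = ?E")
    by (simp add: algebra_simps power2_eq_square flip: fls_const_numeral)
  then have E: "?E = fps_to_fls r" using assms by (rule trans[OF sym])
  have "fls_nth ?E (k - 1) = 0" unfolding E using k by simp
  then have "fls_nth v k = 0"
    using k by (simp add: low fls_X_times_conv_shift)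
  then show False using k by (simp add: k_def nth_fls_subdegree_zero_iff)
qed

subsection \<open>The recurrence\<close>

locale motzkin_recurrence =
  fixes m :: "nat \<Rightarrow> rat" and M :: "rat fps"
  assumes rec: "n \<ge> 2 \<Longrightarrow>
      (of_nat n + 2) * m n = (2 * of_nat n + 1) * m (n - 1) + (3 * of_nat n - 3) * m (n - 2)"
  defines "M \<equiv> Abs_fps m"
begin

lemma rec': "(of_nat n + 4) * m (n + 2) = (2 * of_nat n + 5) * m (n + 1) + (3 * of_nat n + 3) * m n"
  using rec[of "n + 2"] by (simp add: algebra_simps)

text \<open>Both sides satisfy the same recurrence, whose leading coefficient never vanishes, and
  they agree at 0 and 1.\<close>

lemma eq_motzkin:
  assumes "m 0 = m 1"
  shows "m n = m 0 * motzkin n"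
proof (induction n rule: less_induct)
  case (less n)
  consider "n = 0" | "n = 1" | k where "n = k + 2"
    by (metis One_nat_def add_2_eq_Suc' not0_implies_Suc)
  then show ?case
  proof cases
    case 3
    have "(of_nat k + 4) * m (k + 2) =
        m 0 * ((2 * of_nat k + 5) * motzkin (k + 1) + (3 * of_nat k + 3) * motzkin k)"
      unfolding rec' using less[of k] less[of "k + 1"] 3 by (simp add: algebra_simps)
    also have "\<dots> = (of_nat k + 4) * (m 0 * motzkin (k + 2))"
      unfolding motzkin_rec[symmetric] by (simp add: algebra_simps)
    finally show ?thesis using 3 by (simp add: add_pos_nonneg[THEN less_imp_neq] ac_simps del: of_nat_Suc)
  qed (use assms motzkin_0 motzkin_1 in simp_all)
qed

lemma abs_bound: "\<bar>m n\<bar> \<le> (\<bar>m 0\<bar> + \<bar>m 1\<bar>) * 3 ^ n"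
proof (induction n rule: less_induct)
  case (less n)
  let ?B = "\<bar>m 0\<bar> + \<bar>m 1\<bar>"
  consider "n = 0" | "n = 1" | k where "n = k + 2"
    by (metis One_nat_def add_2_eq_Suc' not0_implies_Suc)
  then show ?case
  proof cases
    case 3
    have "(of_nat k + 4) * \<bar>m (k + 2)\<bar> = \<bar>(2 * of_nat k + 5) * m (k + 1) + (3 * of_nat k + 3) * m k\<bar>"
      unfolding rec'[symmetric] by (simp add: abs_mult)
    also have "\<dots> \<le> (2 * of_nat k + 5) * \<bar>m (k + 1)\<bar> + (3 * of_nat k + 3) * \<bar>m k\<bar>"
      by (rule order_trans[OF abs_triangle_ineq]) (simp add: abs_mult)
    also have "\<dots> \<le> (2 * of_nat k + 5) * (?B * 3 ^ (k + 1)) + (3 * of_nat k + 3) * (?B * 3 ^ k)"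
      using less[of k] less[of "k + 1"] 3 by (intro add_mono mult_left_mono) simp_all
    \<comment> \<open>Here 3 (2k + 5) + (3k + 3) = 9 (k + 2), which closes the induction with ratio
      3.\<close>
    also have "\<dots> = (of_nat k + 2) * (?B * 3 ^ (k + 2))" by (simp add: algebra_simps)
    also have "\<dots> \<le> (of_nat k + 4) * (?B * 3 ^ (k + 2))" by (intro mult_right_mono) simp_all
    finally show ?thesis using 3 by (simp add: add_nonneg_pos)
  qed (simp_all)
qed

lemma conv_radius_pos: "fps_conv_radius (complex_fps M) > 0"
  using abs_bound by (intro geometric_bound_conv_radius[of M _ 3]) (simp_all add: M_def)

text \<open>The factor x^2 moves \<open>m n\<close> to exponent n + 2, so the factor n + 2 of the
  recurrence comes from the derivative. From exponent 3 on the coefficients express the recurrence;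
  those at 1 and 2 give the right side.\<close>

lemma shifted_ode:
  "fps_of_poly motzkin_disc * fps_deriv (fps_X ^ 2 * M) + (1 + 3 * fps_X) * (fps_X ^ 2 * M) =
     fps_const (2 * m 0) * fps_X + fps_const (3 * (m 1 - m 0)) * fps_X ^ 2"
proof (rule fps_ext)
  fix n
  define v where "v = fps_X ^ 2 * M"
  have v: "fps_nth v n = (if n < 2 then 0 else m (n - 2))" for n
    by (simp add: v_def M_def fps_X_power_mult_nth)
  have "fps_of_poly motzkin_disc * fps_deriv v + (1 + 3 * fps_X) * v =
      fps_deriv v - fps_const 2 * (fps_X * fps_deriv v) - fps_const 3 * (fps_X * (fps_X * fps_deriv v))
      + v + fps_const 3 * (fps_X * v)" (is "?L = ?R")
    by (simp add: fps_of_motzkin_disc algebra_simps power2_eq_square numeral_fps_const)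
  moreover have "fps_nth ?R n =
      fps_nth (fps_const (2 * m 0) * fps_X + fps_const (3 * (m 1 - m 0)) * fps_X ^ 2) n"
  proof -
    consider "n = 0" | "n = 1" | "n = 2" | k where "n = k + 3"
      by atomize_elim presburger
    then show ?thesis
    proof cases
      case 4
      then show ?thesis using rec'[of k] by (simp add: v fps_X_power_nth algebra_simps eval_nat_numeral)
    qed (simp_all add: v fps_X_power_nth eval_nat_numeral)
  qed
  ultimately show "fps_nth ?L n =
      fps_nth (fps_const (2 * m 0) * fps_X + fps_const (3 * (m 1 - m 0)) * fps_X ^ 2) n"
    by simp
qed

section \<open>Necessity of equal initial values\<close>

lemma geometric_denominators_imp_eq:
  assumes "geometric_denominators m"
  shows "m 0 = m 1"
proof -
  have nth: "fps_nth (fps_X ^ 2 * M) n = (if n < 2 then 0 else m (n - 2))" for n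
    by (simp add: M_def fps_X_power_mult_nth)
  have "geometric_denominators (fps_nth (fps_X ^ 2 * M))"
    by (rule geometric_denominators_shift[where k = 2]) (use assms in \<open>simp_all add: nth\<close>)
  from motzkin_ode_geometric_denominators[OF shifted_ode this] show ?thesis by simp
qed

lemma fps_nth_M: "fps_nth M = m"
  by (simp add: M_def fun_eq_iff)

lemma algebraic_imp_eq:
  assumes "algebraic_fps M"
  shows "m 0 = m 1"
proof -
  define y where "y = fps_to_fls M"
  define D :: "rat fls" where "D = 1 - 2 * fls_X - 3 * fls_X ^ 2"
  define c :: "rat fls" where "c = 2 - 3 * fls_X - 3 * fls_X ^ 2"
  define r where "r = fls_const (2 * m 0) + fls_const (3 * (m 1 - m 0)) * fls_X"
  have D: "D = fls_of_poly motzkin_disc"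
    by (simp add: D_def fps_of_motzkin_disc fls_times_fps_to_fls fps_to_fls_power)
  have "D \<noteq> 0" unfolding D fls_of_poly_eq_0_iff by (simp add: motzkin_disc_def)
  \<comment> \<open>Solves the equation of x^2 z for \<open>z'\<close>; the factor \<open>c\<close>
    is 2 \<open>D\<close> + x (1 + 3x).\<close>
  have ode_iff: "D * fls_deriv (fls_X ^ 2 * z) + (1 + 3 * fls_X) * (fls_X ^ 2 * z) =
      fls_X * r \<longleftrightarrow> fls_deriv z = - c / (fls_X * D) * z + r / (fls_X * D)" for z
  proof -
    have "D * fls_deriv (fls_X ^ 2 * z) + (1 + 3 * fls_X) * (fls_X ^ 2 * z) =
        fls_X * (fls_X * D * fls_deriv z + c * z)"
      by (simp add: D_def c_def algebra_simps power2_eq_square)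
    moreover have "x * (x * D * z' + c * z) = x * r \<longleftrightarrow> z' = - c / (x * D) * z + r / (x * D)"
      if "x \<noteq> 0" for x z' :: "rat fls"
    proof -
      have "x * (x * D * z' + c * z) = x * r \<longleftrightarrow> x * D * z' + c * z = r"
        using that by simp
      then show ?thesis using that \<open>D \<noteq> 0\<close> by (auto simp: field_simps)
    qed
    ultimately show ?thesis by simp
  qed
  have "D * fls_deriv (fls_X ^ 2 * y) + (1 + 3 * fls_X) * (fls_X ^ 2 * y) =
      fps_to_fls (fps_of_poly motzkin_disc * fps_deriv (fps_X ^ 2 * M) + (1 + 3 * fps_X) * (fps_X ^ 2 * M))"
    by (simp only: D y_def fls_times_fps_to_fls fps_to_fls_plus fps_to_fls_power fls_deriv_fps_to_fls[symmetric]
        fps_X_to_fls fps_one_to_fls fps_to_fls_numeral)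
  also have "\<dots> = fls_X * r"
    unfolding shifted_ode
    by (simp add: r_def fls_times_fps_to_fls algebra_simps power2_eq_square)
  finally have ode: "fls_deriv y = - c / (fls_X * D) * y + r / (fls_X * D)"
    unfolding ode_iff .
  have X: "fls_X \<in> ratfun_fls" "D \<in> ratfun_fls" "c \<in> ratfun_fls" "r \<in> ratfun_fls"
  proof -
    have "fls_X = fls_of_poly [:0, 1:]" by simp
    then show "fls_X \<in> ratfun_fls" by (metis fls_of_poly_in_ratfun_fls)
    show "D \<in> ratfun_fls" unfolding D by (rule fls_of_poly_in_ratfun_fls)
    have "c = fls_of_poly [:2, -3, -3:]"
      by (simp add: c_def fps_of_poly_pCons fls_times_fps_to_fls algebra_simps power2_eq_square
          flip: fls_const_numeral)
    then show "c \<in> ratfun_fls" by (metis fls_of_poly_in_ratfun_fls)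
    have "r = fls_of_poly [:2 * m 0, 3 * (m 1 - m 0):]"
      by (simp add: r_def fps_of_poly_pCons fls_times_fps_to_fls)
    then show "r \<in> ratfun_fls" by (metis fls_of_poly_in_ratfun_fls)
  qed
  obtain T where T: "T \<in> ratfun_fls" "fls_deriv T = - c / (fls_X * D) * T + r / (fls_X * D)"
    by (rule algebraic_imp_rational_solution[OF assms _ _ ode[unfolded y_def]])
      (intro ratfun_fls_divide ratfun_fls_uminus ratfun_fls_mult X)+
  define V where "V = fls_X ^ 2 * T"
  define v where "v = fls_regpart V"
  have V: "D * fls_deriv V + (1 + 3 * fls_X) * V = fls_X * r"
    unfolding V_def ode_iff by (rule T(2))
  have r: "fls_X * r = fps_to_fls (fps_const (2 * m 0) * fps_X + fps_const (3 * (m 1 - m 0)) * fps_X ^ 2)"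
    by (simp add: r_def fls_times_fps_to_fls algebra_simps power2_eq_square)
  \<comment> \<open>A priori \<open>V\<close> is only a Laurent series; the differential equation
    excludes a pole at 0.\<close>
  have "fls_subdegree V \<ge> 0"
    using V motzkin_ode_fls_subdegree_nonneg unfolding D_def r by blast
  then have v: "V = fps_to_fls v" by (simp add: v_def)
  have "fps_to_fls (fps_of_poly motzkin_disc * fps_deriv v + (1 + 3 * fps_X) * v) = fls_X * r"
    unfolding V[symmetric] v D
    by (simp add: fls_times_fps_to_fls fls_deriv_fps_to_fls)
  then have ode_v: "fps_of_poly motzkin_disc * fps_deriv v + (1 + 3 * fps_X) * v =
      fps_const (2 * m 0) * fps_X + fps_const (3 * (m 1 - m 0)) * fps_X ^ 2"
    unfolding r fps_to_fls_eq_iff .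
  obtain p q where q: "q \<noteq> 0" and pq: "T = fls_of_poly p / fls_of_poly q"
    using T(1) by (elim ratfun_flsE)
  have "fls_of_poly q * V = fls_X ^ 2 * fls_of_poly p"
    using q by (simp add: V_def pq)
  then have "fps_to_fls (fps_of_poly q * v) = fps_to_fls (fps_of_poly ([:0, 1:] ^ 2 * p))"
    by (simp only: v fls_times_fps_to_fls fps_to_fls_power fps_of_poly_mult fps_of_poly_power
        fps_of_poly_fps_X fps_X_to_fls)
  then have "fps_of_poly q * v = fps_of_poly ([:0, 1:] ^ 2 * p)"
    unfolding fps_to_fls_eq_iff .
  then have "geometric_denominators (fps_nth v)"
    using q by (rule geometric_denominators_rational)
  from motzkin_ode_geometric_denominators[OF ode_v this] show ?thesis by simp
qed

section \<open>Sufficiency of equal initial values\<close>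

text \<open>The base \<open>S\<close> of the square satisfies \<open>D * S' = D' * S / 2\<close>.
  Hence S^2 / \<open>D\<close> has derivative zero and equals its value at 0, the square of
  \<open>m 0\<close>.\<close>

lemma eq_imp_quadratic:
  assumes "m 0 = m 1"
  shows "(fps_const (m 0) * (1 - fps_X) - 2 * (fps_X ^ 2 * M)) ^ 2 =
    fps_const (m 0) ^ 2 * fps_of_poly motzkin_disc"
proof -
  define D where "D = fps_of_poly motzkin_disc"
  define a where "a = fps_const (m 0)"
  define v where "v = fps_X ^ 2 * M"
  define S where "S = a * (1 - fps_X) - 2 * v"
  have D: "D = 1 - 2 * fps_X - 3 * fps_X ^ 2" unfolding D_def by (rule fps_of_motzkin_disc)
  have "fps_nth D 0 \<noteq> 0" by (simp add: D)
  then have "D \<noteq> 0" by auto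
  have D': "fps_deriv D = - (2 * (1 + 3 * fps_X))"
    by (simp add: D fps_deriv_power algebra_simps)
  have v: "D * fps_deriv v = 2 * a * fps_X - (1 + 3 * fps_X) * v"
    using shifted_ode assms
    by (simp add: D_def v_def a_def algebra_simps flip: fps_const_mult numeral_fps_const)
  have S': "D * fps_deriv S = - ((1 + 3 * fps_X) * S)"
  proof -
    have "D * fps_deriv S = - (a * D) - 2 * (D * fps_deriv v)"
      by (simp add: S_def a_def algebra_simps flip: fps_const_neg)
    then show ?thesis unfolding v by (simp add: D S_def algebra_simps power2_eq_square)
  qed
  define W where "W = S ^ 2 * inverse D"
  have W: "S ^ 2 = W * D"
    using \<open>fps_nth D 0 \<noteq> 0\<close> by (simp add: W_def inverse_mult_eq_1 mult.assoc)
  have "D ^ 2 * fps_deriv W = D * fps_deriv (S ^ 2) - S ^ 2 * fps_deriv D"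
    unfolding W by (simp add: algebra_simps power2_eq_square)
  also have "D * fps_deriv (S ^ 2) = 2 * S * (D * fps_deriv S)"
    by (simp add: power2_eq_square algebra_simps)
  also have "2 * S * (D * fps_deriv S) - S ^ 2 * fps_deriv D = 0"
    unfolding S' D' by (simp add: power2_eq_square algebra_simps)
  finally have "fps_deriv W = 0" using \<open>D \<noteq> 0\<close> by simp
  then have "W = fps_const (fps_nth W 0)" by (simp add: fps_deriv_eq_0_iff)
  also have "fps_nth W 0 = m 0 ^ 2"
    by (simp add: W_def S_def v_def a_def D power2_eq_square)
  finally have "W = a ^ 2" by (simp add: a_def power2_eq_square)
  with W show ?thesis by (simp add: S_def v_def a_def D_def)
qed

lemma eq_imp_algebraic:
  assumes "m 0 = m 1"
  shows "algebraic_fps M"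
proof -
  define a where "a = m 0"
  define u where "u = [:fls_of_poly [:a, -a:], - fls_of_poly [:0, 0, 2:]:]"
  define P where "P = u ^ 2 - [:fls_of_poly (smult (a ^ 2) motzkin_disc):]"
  have u: "fls_of_poly [:a, -a:] - fls_of_poly [:0, 0, 2:] * fps_to_fls M =
      fps_to_fls (fps_const a * (1 - fps_X) - 2 * (fps_X ^ 2 * M))"
    by (simp add: fps_of_poly_pCons fls_times_fps_to_fls algebra_simps power2_eq_square
        flip: fls_const_numeral)
  have "poly P (fps_to_fls M) =
      (fls_of_poly [:a, -a:] - fls_of_poly [:0, 0, 2:] * fps_to_fls M) ^ 2
        - fls_of_poly (smult (a ^ 2) motzkin_disc)"
    by (simp add: P_def u_def algebra_simps)
  also have "\<dots> = 0"
    unfolding u unfolding fps_to_fls_power[symmetric] a_def eq_imp_quadratic[OF assms]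
    by (simp add: fps_of_poly_smult power2_eq_square)
  finally have "poly P (fps_to_fls M) = 0" .
  have P: "P = [:fls_of_poly ([:a, -a:] ^ 2 - smult (a ^ 2) motzkin_disc),
      fls_of_poly (- ([:a, -a:] * [:0, 0, 2:] + [:a, -a:] * [:0, 0, 2:])), fls_of_poly ([:0, 0, 2:] ^ 2):]"
    by (simp only: P_def u_def fls_of_poly_simps fps_of_poly_uminus fps_to_fls_uminus power2_eq_square)
       (simp add: algebra_simps)
  \<comment> \<open>The leading coefficient is 4 x^4, so \<open>P\<close> is nonzero even for
    \<open>m 0 = 0\<close>.\<close>
  moreover have "coeff P 2 \<noteq> 0"
    unfolding P by (simp add: eval_nat_numeral)
  then have "P \<noteq> 0" by auto
  moreover have "coeff P i \<in> ratfun_fls" for i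
    unfolding P
    by (auto simp: coeff_pCons simp del: mult_pCons_left mult_pCons_right split: nat.split
        intro: fls_of_poly_in_ratfun_fls ratfun_fls_0)
  ultimately show ?thesis
    using \<open>poly P (fps_to_fls M) = 0\<close> unfolding algebraic_fps_def by blast
qed

text \<open>Expanding \<open>m 0\<close> (1 - y^2) / (1 - x (1 + y + y^2)) as a geometric series in
  x yields the products in the definition of \<open>motzkin\<close> as its rows.\<close>

lemma eq_imp_diagonal:
  assumes "m 0 = m 1"
  shows "diagonal_of_bivariate_ratfun M"
proof -
  define P :: "rat fps" where "P = 1 + fps_X + fps_X ^ 2"
  define K :: "rat fps" where "K = 1 - fps_X ^ 2"
  define F where "F = Abs_fps (\<lambda>n. fps_const (m 0) * (P ^ n * K))"
  define num where "num = [:[:m 0, 0, - m 0:]:]"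
  define den where "den = ([:1, - [:1, 1, 1:]:] :: rat poly poly)"
  have num: "fps2_of_poly2 num = fps_const (fps_const (m 0) * K)"
    by (simp add: num_def fps2_of_poly2_def map_poly_pCons fps_of_poly_const K_def
        fps_of_poly_pCons power2_eq_square algebra_simps)
  have den: "fps2_of_poly2 den = 1 - fps_X * fps_const P"
    by (simp add: den_def fps2_of_poly2_def map_poly_pCons fps_of_poly_pCons P_def
        power2_eq_square algebra_simps fps_const_neg[symmetric] del: fps_const_neg)
  have "fps2_of_poly2 den * F = fps2_of_poly2 num"
  proof (rule fps_ext)
    fix n
    have "fps2_of_poly2 den * F = F - fps_X * (fps_const P * F)"
      by (simp add: den algebra_simps)
    then show "fps_nth (fps2_of_poly2 den * F) n = fps_nth (fps2_of_poly2 num) n"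
      unfolding num by (cases n) (simp_all add: F_def)
  qed
  moreover have "den \<noteq> 0" by (simp add: den_def)
  moreover have "M = diagonal F"
  proof (rule fps_ext)
    show "fps_nth M n = fps_nth (diagonal F) n" for n
      unfolding fps_nth_M eq_motzkin[OF assms, of n]
      by (simp add: diagonal_def F_def motzkin_def P_def K_def)
  qed
  ultimately show ?thesis
    unfolding diagonal_of_bivariate_ratfun_def has_fps2_expansion_def by blast
qed

lemma eq_imp_bounded_denominator:
  assumes "m 0 = m 1"
  shows "\<exists>b :: int. b \<noteq> 0 \<and> (\<forall>n. \<exists>k :: int. m n = of_int k / of_int b)"
proof -
  \<comment> \<open>The denominator of \<open>m 0\<close> serves for every \<open>n\<close>, because
    the Motzkin numbers are integers.\<close>
  obtain b :: int where b: "b \<noteq> 0" "of_int b * m 0 \<in> \<int>" by (rule rat_common_denominator)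
  have "\<exists>k :: int. m n = of_int k / of_int b" for n
  proof -
    have "of_int b * m 0 * motzkin n \<in> \<int>" by (intro Ints_mult b motzkin_Ints)
    then obtain k where "of_int b * m n = of_int k"
      using eq_motzkin[OF assms, of n] by (auto simp: mult.assoc elim: Ints_cases)
    then show ?thesis using b(1) by (intro exI[of _ k]) (simp add: field_simps)
  qed
  with b(1) show ?thesis by blast
qed

section \<open>Assembling the equivalences\<close>

lemma bounded_denominator_imp_almost_integral:
  assumes "b \<noteq> 0" "\<And>n. \<exists>k :: int. m n = of_int k / of_int b"
  shows "almost_integral M"
proof -
  have "of_int b ^ n * m n \<in> \<int>" if "n \<ge> 1" for n
  proof -
    obtain k where "m n = of_int k / of_int b" using assms(2) by blast
    then have "of_int b ^ n * m n = of_int (b ^ (n - 1) * k)"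
      using that \<open>b \<noteq> 0\<close> by (cases n) simp_all
    then show ?thesis by (metis Ints_of_int)
  qed
  then show ?thesis using \<open>b \<noteq> 0\<close> unfolding almost_integral_def M_def by auto
qed

lemma almost_integral_imp_eq: "almost_integral M \<Longrightarrow> m 0 = m 1"
  using almost_integral_imp_geometric_denominators[of M] geometric_denominators_imp_eq
  by (simp add: fps_nth_M)

lemma diagonal_imp_eq: "diagonal_of_bivariate_ratfun M \<Longrightarrow> m 0 = m 1"
  using geometric_denominators_diagonal[of M] geometric_denominators_imp_eq
  by (simp add: fps_nth_M)

end

theorem theorem3p1:
  fixes m :: "nat \<Rightarrow> rat" and M :: "rat fps"
  assumes rec: "\<And>n. n \<ge> 2 \<Longrightarrow>
      (of_nat n + 2) * m n = (2 * of_nat n + 1) * m (n - 1) + (3 * of_nat n - 3) * m (n - 2)"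
    and M: "M = Abs_fps m"
  shows "(algebraic_fps M \<longleftrightarrow> globally_bounded M) \<and>
         (globally_bounded M \<longleftrightarrow>
            (\<exists>b :: int. b \<noteq> 0 \<and> (\<forall>n. \<exists>k :: int. m n = of_int k / of_int b))) \<and>
         ((\<exists>b :: int. b \<noteq> 0 \<and> (\<forall>n. \<exists>k :: int. m n = of_int k / of_int b)) \<longleftrightarrow> m 0 = m 1) \<and>
         (m 0 = m 1 \<longleftrightarrow> diagonal_of_bivariate_ratfun M)"
proof -
  interpret motzkin_recurrence m "Abs_fps m"
    by unfold_locales (use rec in auto)
  \<comment> \<open>Each of the other four conditions is compared with
    \<open>m 0 = m 1\<close>.\<close>
  have eq_iff_bounded:
    "(\<exists>b :: int. b \<noteq> 0 \<and> (\<forall>n. \<exists>k :: int. m n = of_int k / of_int b)) \<longleftrightarrow> m 0 = m 1"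
    using eq_imp_bounded_denominator bounded_denominator_imp_almost_integral almost_integral_imp_eq
    by blast
  then have "almost_integral M \<longleftrightarrow> m 0 = m 1"
    using bounded_denominator_imp_almost_integral almost_integral_imp_eq unfolding M by blast
  then have "globally_bounded M \<longleftrightarrow> m 0 = m 1"
    using conv_radius_pos unfolding globally_bounded_def M by blast
  moreover have "algebraic_fps M \<longleftrightarrow> m 0 = m 1"
    unfolding M using algebraic_imp_eq eq_imp_algebraic by blast
  moreover have "diagonal_of_bivariate_ratfun M \<longleftrightarrow> m 0 = m 1"
    unfolding M using diagonal_imp_eq eq_imp_diagonal by blast
  ultimately show ?thesis using eq_iff_bounded by simp
qed

end
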